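(* Let $N>1$ and let $\nu_1,\nu_2\in\mathcal{M}_N^e$ be such that $\nu_1(E)=\nu_2(E)$ for every ellipsoid $E\subset\mathbf{R}^N$ centered at $0$. Then $\nu_1=\nu_2$.
   Context: $\mathcal{M}_N$ is the set of Borel measures $\nu$ on $\mathbf{R}^N$ such that $\sup_{R>0}\nu(B(0,R))/R^N<\infty$, where $B(0,R)$ is the open ball of radius $R$ about $0$. $\mathcal{M}_N^e=\{\nu\in\mathcal{M}_N\mid\nu(-U)=\nu(U)\text{ for all Borel }U\}$. An ellipsoid centered at $0$ is the image of the open unit ball under an invertible linear map of $\mathbf{R}^N$. *)

theory Defs
  imports "HOL-Analysis.Analysis"
begin

text \<open>The dimension \<open>N\<close> is \<open>CARD('n)\<close>. Measures are nonnegative with values in \<^typ>\<open>ennreal\<close>, so the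
  quotients below are formed there and the growth condition says that their supremum is finite.\<close>

definition growth_measures :: "(real ^ 'n::finite) measure set" where
  "growth_measures = {\<nu>. sets \<nu> = sets borel \<and>
     (SUP R \<in> {0::real<..}. emeasure \<nu> (ball 0 R) / ennreal (R ^ CARD('n))) < \<infinity>}"

definition even_growth_measures :: "(real ^ 'n::finite) measure set" where
  "even_growth_measures = {\<nu> \<in> growth_measures.
     \<forall>U \<in> sets borel. emeasure \<nu> (uminus ` U) = emeasure \<nu> U}"

definition centered_ellipsoid :: "(real ^ 'n::finite) set \<Rightarrow> bool" where
  "centered_ellipsoid E \<longleftrightarrow> (\<exists>T :: real ^ 'n \<Rightarrow> real ^ 'n. linear T \<and> bij T \<and> E = T ` ball 0 1)"

end

theory Submission
  imports Defs
begin

text \<open>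
  An ellipsoid centered at the origin is a sublevel set \<open>{x. q x < t}\<close> of a positive definite
  quadratic form \<open>q\<close>. So the hypothesis says that \<open>\<nu>\<^sub>1\<close> and \<open>\<nu>\<^sub>2\<close> give the same distribution to every
  such form, and therefore \<open>exp (- q x)\<close> has the same integral under both. This is equality of
  the Laplace transforms of the images of the two measures under \<open>x \<mapsto> x x\<^sup>T\<close>, and a Laplace
  transform should determine the measure. As \<open>x x\<^sup>T\<close> determines \<open>x\<close> up to sign, an even measure is
  then recovered.

  Uniqueness of the transform is reduced to the moment problem on a cube. The growth condition makes
  \<open>exp (- (norm x)\<^sup>2) \<nu>\<close> a finite measure (\<open>finite_gaussian_weighted\<close>), and \<open>\<nu>\<close> can be recovered from
  it. Only the forms \<open>(norm x)\<^sup>2 + (\<Sum>v. (v \<bullet> x)\<^sup>2)\<close> are needed, and these define ellipsoids because a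
  form \<open>(norm (S x))\<^sup>2\<close> with \<open>S\<close> invertible keeps this shape when one square \<open>(v \<bullet> x)\<^sup>2\<close> is
  added (\<open>linear_rank_one_update\<close>). The map \<open>\<Phi> x = (exp (- (x\<^sub>i + x\<^sub>j)\<^sup>2))\<^sub>i\<^sub>j\<close> sends the space into a
  cube and identifies exactly \<open>x\<close> with \<open>- x\<close> (\<open>sign_embedding_eq_iff\<close>). A monomial in the coordinates
  of \<open>\<Phi> x\<close> is again \<open>exp\<close> of minus a sum of squares, so the images of the two weighted measures
  under \<open>\<Phi>\<close> have the same moments, and they agree by the Weierstrass approximation theorem
  (\<open>finite_measure_eqI_moments\<close>). Hence the weighted measures agree on compact sets symmetric about the
  origin, which is enough for even measures (\<open>even_finite_measure_eqI\<close>).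
\<close>

section \<open>Ellipsoids as sublevel sets of quadratic forms\<close>

definition sum_squares :: "'a::real_inner list \<Rightarrow> 'a \<Rightarrow> real" where
  "sum_squares vs x = (\<Sum>v\<leftarrow>vs. (v \<bullet> x)\<^sup>2)"

lemma sum_squares_simps [simp]:
  "sum_squares [] x = 0"
  "sum_squares (v # vs) x = (v \<bullet> x)\<^sup>2 + sum_squares vs x"
  "sum_squares (vs @ ws) x = sum_squares vs x + sum_squares ws x"
  by (simp_all add: sum_squares_def)

lemma sum_squares_nonneg [simp]: "sum_squares vs x \<ge> 0"
  by (induction vs) simp_all

lemma continuous_sum_squares [continuous_intros]: "continuous_on A (sum_squares vs)"
proof (induction vs)
  case Nil
  then show ?case by (simp add: continuous_on_const cong: continuous_on_cong)
next
  case (Cons v vs)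
  have "continuous_on A (\<lambda>x. (v \<bullet> x)\<^sup>2 + sum_squares vs x)"
    by (intro continuous_intros Cons)
  then show ?case by (simp cong: continuous_on_cong)
qed

lemma borel_measurable_sum_squares [measurable]:
  "sum_squares vs \<in> borel_measurable (borel :: 'a::euclidean_space measure)"
  by (intro borel_measurable_continuous_onI continuous_sum_squares)

text \<open>Adding the square of one linear functional to \<open>(norm (S x))\<^sup>2\<close> amounts to composing \<open>S\<close> with
  \<open>I + c w w\<^sup>T\<close>, where \<open>w\<close> is the vector with \<open>w \<bullet> S x = v \<bullet> x\<close>. Repeating this gives a square root of
  every form used below, without the spectral theorem.\<close>

lemma linear_rank_one_update:
  fixes S :: "'a::euclidean_space \<Rightarrow> 'a"
  assumes S: "linear S" "bij S"
  shows "\<exists>S' :: 'a \<Rightarrow> 'a. linear S' \<and> bij S' \<and> (\<forall>x. (norm (S' x))\<^sup>2 = (norm (S x))\<^sup>2 + (v \<bullet> x)\<^sup>2)"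
proof -
  have inv_lin: "linear (inv S)"
    using S by (simp add: bij_is_inj bij_is_surj inj_linear_imp_inv_linear)
  define w where "w = adjoint (inv S) v"
  have w: "w \<bullet> S x = v \<bullet> x" for x
  proof -
    have "S x \<bullet> adjoint (inv S) v = inv S (S x) \<bullet> v"
      by (rule adjoint_works[OF inv_lin])
    then show ?thesis
      using S by (simp add: w_def bij_is_inj inner_commute)
  qed
  \<comment> \<open>The cross term and the square term of \<open>(norm (S x + c (v \<bullet> x) w))\<^sup>2\<close> contribute
    \<open>(2 c + c\<^sup>2 (norm w)\<^sup>2) (v \<bullet> x)\<^sup>2\<close>, so \<open>c\<close> is chosen as the positive root of
    \<open>2 c + c\<^sup>2 (norm w)\<^sup>2 = 1\<close>, in a form that stays meaningful for \<open>w = 0\<close>.\<close>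
  define s where "s = sqrt (1 + (norm w)\<^sup>2)"
  define c where "c = 1 / (1 + s)"
  have s0: "s > 0"
    by (simp add: s_def add_pos_nonneg)
  have s2: "(norm w)\<^sup>2 = s\<^sup>2 - 1"
    by (simp add: s_def)
  have c: "2 * c + c\<^sup>2 * (norm w)\<^sup>2 = 1"
  proof -
    have "2 * c + c\<^sup>2 * (norm w)\<^sup>2 = (2 * (1 + s) + (s\<^sup>2 - 1)) / (1 + s)\<^sup>2"
      using s0 unfolding c_def s2 by (simp add: power2_eq_square divide_simps)
    also have "2 * (1 + s) + (s\<^sup>2 - 1) = (1 + s)\<^sup>2"
      by (simp add: power2_eq_square algebra_simps)
    finally show ?thesis
      using s0 by simp
  qed
  define S' where "S' x = S x + (c * (v \<bullet> x)) *\<^sub>R w" for x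
  have norm_S': "(norm (S' x))\<^sup>2 = (norm (S x))\<^sup>2 + (v \<bullet> x)\<^sup>2" for x
  proof -
    have "(norm (S' x))\<^sup>2 = (norm (S x))\<^sup>2 + (v \<bullet> x)\<^sup>2 * (2 * c + c\<^sup>2 * (norm w)\<^sup>2)"
      using w[of x] unfolding S'_def power2_norm_eq_inner
      by (simp add: inner_simps inner_commute power2_eq_square algebra_simps)
    then show ?thesis
      by (simp add: c)
  qed
  have lin: "linear S'"
    unfolding S'_def using S(1)
    by (intro linearI) (simp_all add: linear_add linear_scale inner_simps algebra_simps)
  have "inj S'"
  proof (subst linear_injective_0[OF lin], intro allI impI)
    fix x assume "S' x = 0"
    then have "(norm (S x))\<^sup>2 + (v \<bullet> x)\<^sup>2 = 0"
      using norm_S'[of x] by simp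
    then have "S x = 0"
      by (simp add: add_nonneg_eq_0_iff)
    then show "x = 0"
      using S by (metis bij_is_inj linear_injective_0)
  qed
  then have "bij S'"
    using lin by (simp add: bij_def linear_injective_imp_surjective)
  with lin norm_S' show ?thesis
    by (intro exI[of _ S']) simp
qed

lemma quadratic_form_square_root:
  fixes vs :: "'a::euclidean_space list"
  shows "\<exists>S::'a \<Rightarrow> 'a. linear S \<and> bij S \<and> (\<forall>x. (norm (S x))\<^sup>2 = (norm x)\<^sup>2 + sum_squares vs x)"
proof (induction vs)
  case Nil
  show ?case by (rule exI[of _ "\<lambda>x. x"]) (auto intro: linearI bij_id[unfolded id_def])
next
  case (Cons v vs)
  then obtain S :: "'a \<Rightarrow> 'a" where S: "linear S" "bij S"
    "\<And>x. (norm (S x))\<^sup>2 = (norm x)\<^sup>2 + sum_squares vs x"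
    by blast
  from linear_rank_one_update[OF S(1,2), of v] show ?case
    by (auto simp: S(3) algebra_simps)
qed

lemma centered_ellipsoid_sublevel:
  fixes vs :: "(real ^ 'n::finite) list"
  assumes "t > 0"
  shows "centered_ellipsoid {x. (norm x)\<^sup>2 + sum_squares vs x < t}"
proof -
  obtain S :: "real ^ 'n \<Rightarrow> real ^ 'n" where S: "linear S" "bij S"
    "\<And>x. (norm (S x))\<^sup>2 = (norm x)\<^sup>2 + sum_squares vs x"
    using quadratic_form_square_root by blast
  define T where "T y = inv S (sqrt t *\<^sub>R y)" for y
  have S_inv: "S (inv S y) = y" "inv S (S y) = y" for y
    using S(2) by (simp_all add: bij_is_surj bij_is_inj surj_f_inv_f)
  have "linear (inv S)"
    using S by (simp add: bij_is_inj bij_is_surj inj_linear_imp_inv_linear)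
  then have "linear T"
    unfolding T_def by (intro linearI) (simp_all add: linear_add linear_scale scaleR_add_right)
  have T_S: "T ((1 / sqrt t) *\<^sub>R S x) = x" for x
    using assms by (simp add: T_def S_inv)
  have "bij T"
  proof (rule bijI)
    show "inj T"
      using assms by (intro injI) (metis T_def S_inv(1) real_sqrt_gt_zero scaleR_cancel_left
          less_irrefl)
    show "surj T"
      using T_S by (rule surjI[where f = "\<lambda>x. (1 / sqrt t) *\<^sub>R S x"])
  qed
  have less_iff: "(norm (S x))\<^sup>2 < t \<longleftrightarrow> norm ((1 / sqrt t) *\<^sub>R S x) < 1" for x
  proof -
    have "(norm (S x))\<^sup>2 < t \<longleftrightarrow> norm (S x) < sqrt t"
      using real_less_rsqrt[of "norm (S x)" t] real_sqrt_less_iff[of "(norm (S x))\<^sup>2" t] by auto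
    then show ?thesis
      using assms by (simp add: divide_simps)
  qed
  have "{x. (norm x)\<^sup>2 + sum_squares vs x < t} = T ` ball 0 1"
  proof (intro equalityI subsetI)
    fix x assume "x \<in> {x. (norm x)\<^sup>2 + sum_squares vs x < t}"
    then have "(1 / sqrt t) *\<^sub>R S x \<in> ball 0 1"
      using less_iff[of x] S(3)[of x] by simp
    then show "x \<in> T ` ball 0 1"
      using T_S[of x] by (metis image_eqI)
  next
    fix x assume "x \<in> T ` ball 0 1"
    then obtain y where y: "x = T y" "norm y < 1"
      by auto
    then have "(1 / sqrt t) *\<^sub>R S x = y"
      using assms by (simp add: T_def S_inv)
    then show "x \<in> {x. (norm x)\<^sup>2 + sum_squares vs x < t}"
      using y less_iff[of x] S(3)[of x] by simp
  qed
  then show ?thesis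
    using \<open>linear T\<close> \<open>bij T\<close> unfolding centered_ellipsoid_def by blast
qed

section \<open>Gaussian weights\<close>

lemma growth_measure_ball_bound:
  assumes "\<nu> \<in> growth_measures"
  obtains C :: real where "C \<ge> 0"
    "\<And>R. R > 0 \<Longrightarrow> emeasure (\<nu> :: (real ^ 'n::finite) measure) (ball 0 R) \<le> ennreal (C * R ^ CARD('n))"
proof -
  define S where "S = (SUP R \<in> {0::real<..}. emeasure \<nu> (ball 0 R) / ennreal (R ^ CARD('n)))"
  have "S < \<infinity>"
    using assms by (simp add: growth_measures_def S_def)
  then obtain C where C: "C \<ge> 0" "S = ennreal C"
    by (cases S) auto
  show thesis
  proof (rule that[OF C(1)])
    fix R :: real assume R: "R > 0"
    let ?r = "ennreal (R ^ CARD('n))"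
    have "emeasure \<nu> (ball 0 R) = emeasure \<nu> (ball 0 R) / ?r * ?r"
      using R by (simp add: ennreal_divide_times divide_mult_eq mult_divide_eq_ennreal)
    also have "\<dots> \<le> S * ?r"
      unfolding S_def using R by (intro mult_right_mono SUP_upper) auto
    also have "\<dots> = ennreal (C * R ^ CARD('n))"
      using C R by (simp add: ennreal_mult)
    finally show "emeasure \<nu> (ball 0 R) \<le> ennreal (C * R ^ CARD('n))" .
  qed
qed

lemma growth_measure_ball_finite:
  assumes "\<nu> \<in> growth_measures"
  shows "emeasure \<nu> (ball 0 R) < \<infinity>"
proof (cases "R > 0")
  case True
  then show ?thesis
    using growth_measure_ball_bound[OF assms] by (metis ennreal_less_top infinity_ennreal_def le_less_trans)
qed (simp add: ball_empty)

definition gaussian_weighted :: "'a::euclidean_space measure \<Rightarrow> 'a measure" where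
  "gaussian_weighted \<nu> = density \<nu> (\<lambda>x. ennreal (exp (- (norm x)\<^sup>2)))"

lemma sets_gaussian_weighted [simp, measurable_cong]: "sets (gaussian_weighted \<nu>) = sets \<nu>"
  by (simp add: gaussian_weighted_def)

lemma power_le_fact_times_exp:
  fixes x :: real
  assumes "x \<ge> 0"
  shows "x ^ n \<le> fact n * exp x"
proof -
  have "sum (\<lambda>n. inverse (fact n) * x ^ n) {n} \<le> (\<Sum>n. inverse (fact n) * x ^ n)"
    using assms by (intro sum_le_suminf summable_exp) auto
  also have "\<dots> = exp x"
    by (simp add: exp_def scaleR_conv_of_real)
  finally show ?thesis
    by (simp add: field_simps)
qed

text \<open>The exponential lower bound at \<open>(k + 1) / 2\<close> absorbs the polynomial and costs only half of the
  decay, which leaves a geometric series.\<close>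

lemma summable_poly_times_exp: "summable (\<lambda>k. C * (real k + 1) ^ n * exp (- real k))"
proof -
  have bound: "(real k + 1) ^ n * exp (- real k) \<le> 2 ^ n * fact n * exp (1 / 2) * exp (- 1 / 2) ^ k" for k
  proof -
    have "(real k + 1) ^ n = 2 ^ n * ((real k + 1) / 2) ^ n"
      by (simp add: power_divide)
    also have "\<dots> \<le> 2 ^ n * (fact n * exp ((real k + 1) / 2))"
      by (intro mult_left_mono power_le_fact_times_exp) auto
    finally have "(real k + 1) ^ n * exp (- real k)
        \<le> 2 ^ n * (fact n * exp ((real k + 1) / 2)) * exp (- real k)"
      by (intro mult_right_mono) auto
    also have "\<dots> = 2 ^ n * fact n * (exp ((real k + 1) / 2) * exp (- real k))"
      by simp
    also have "exp ((real k + 1) / 2) * exp (- real k) = exp (1 / 2) * exp (real k * (- 1 / 2))"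
      by (simp add: exp_add[symmetric] field_simps)
    also have "exp (real k * (- 1 / 2)) = exp (- 1 / 2) ^ k"
      by (rule exp_of_nat_mult)
    finally show ?thesis
      by (simp add: mult.assoc)
  qed
  have "summable (\<lambda>k. (real k + 1) ^ n * exp (- real k))"
  proof (rule summable_comparison_test)
    show "\<exists>N. \<forall>k\<ge>N. norm ((real k + 1) ^ n * exp (- real k))
        \<le> 2 ^ n * fact n * exp (1 / 2) * exp (- 1 / 2) ^ k"
      using bound by (intro exI[of _ 0]) (simp add: abs_mult)
    show "summable (\<lambda>k. 2 ^ n * fact n * exp (1 / 2) * exp (- 1 / 2 :: real) ^ k)"
      by (intro summable_mult summable_geometric) simp
  qed
  then have "summable (\<lambda>k. C * ((real k + 1) ^ n * exp (- real k)))"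
    by (rule summable_mult)
  then show ?thesis
    by (simp add: mult.assoc)
qed

text \<open>On the shell \<open>k \<le> norm x < k + 1\<close> the weight is at most \<open>exp (- k)\<close>, while the growth condition
  bounds the mass of the shell by a polynomial in \<open>k\<close>.\<close>

lemma finite_gaussian_weighted:
  fixes \<nu> :: "(real ^ 'n::finite) measure"
  assumes "\<nu> \<in> growth_measures"
  shows "finite_measure (gaussian_weighted \<nu>)"
proof
  have [measurable_cong, simp]: "sets \<nu> = sets borel"
    using assms by (simp add: growth_measures_def)
  have [simp]: "space \<nu> = UNIV"
    using sets_eq_imp_space_eq[of \<nu> borel] by simp
  obtain C where C: "C \<ge> 0"
    "\<And>R. R > 0 \<Longrightarrow> emeasure \<nu> (ball 0 R) \<le> ennreal (C * R ^ CARD('n))"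
    using growth_measure_ball_bound[OF assms] by blast
  have le: "ennreal (exp (- (norm x)\<^sup>2))
      \<le> (\<Sum>k. ennreal (exp (- real k)) * indicator (ball 0 (real k + 1)) x)" for x :: "real ^ 'n"
  proof -
    define k where "k = nat \<lfloor>norm x\<rfloor>"
    have k: "real k \<le> norm x" "norm x < real k + 1"
      by (simp_all add: k_def)
    have "real k \<le> (real k)\<^sup>2"
      by (cases k) (simp_all add: power2_eq_square)
    also have "\<dots> \<le> (norm x)\<^sup>2"
      using k by (intro power_mono) auto
    finally have "ennreal (exp (- (norm x)\<^sup>2))
        \<le> ennreal (exp (- real k)) * indicator (ball 0 (real k + 1)) x"
      using k by (auto intro!: ennreal_leI)
    also have "\<dots> \<le> (\<Sum>k. ennreal (exp (- real k)) * indicator (ball 0 (real k + 1)) x)"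
      using sum_le_suminf[of "\<lambda>k. ennreal (exp (- real k)) * indicator (ball 0 (real k + 1)) x" "{k}"]
      by (simp del: sum_mult_indicator)
    finally show ?thesis .
  qed
  have "emeasure (gaussian_weighted \<nu>) (space (gaussian_weighted \<nu>))
      = (\<integral>\<^sup>+x. ennreal (exp (- (norm x)\<^sup>2)) \<partial>\<nu>)"
    by (simp add: gaussian_weighted_def emeasure_density)
  also have "\<dots> \<le> (\<integral>\<^sup>+x. (\<Sum>k. ennreal (exp (- real k)) * indicator (ball 0 (real k + 1)) x) \<partial>\<nu>)"
    by (intro nn_integral_mono le)
  also have "\<dots> = (\<Sum>k. ennreal (exp (- real k)) * emeasure \<nu> (ball 0 (real k + 1)))"
  proof (subst nn_integral_suminf)
    fix k
    have "ball 0 (real k + 1) \<in> sets \<nu>"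
      by simp
    then show "(\<lambda>x. ennreal (exp (- real k)) * indicator (ball 0 (real k + 1)) x) \<in> borel_measurable \<nu>"
      by (intro borel_measurable_times_ennreal borel_measurable_indicator) auto
  qed (simp add: nn_integral_cmult_indicator)
  also have "\<dots> \<le> (\<Sum>k. ennreal (exp (- real k) * (C * (real k + 1) ^ CARD('n))))"
    using C by (intro suminf_le) (auto simp: ennreal_mult intro!: mult_left_mono)
  also have "\<dots> < \<infinity>"
  proof -
    have "summable (\<lambda>k. C * (real k + 1) ^ CARD('n) * exp (- real k))"
      by (rule summable_poly_times_exp)
    then have "summable (\<lambda>k. exp (- real k) * (C * (real k + 1) ^ CARD('n)))"
      by (simp add: ac_simps)
    then show ?thesis
      using C by (subst suminf_ennreal2) auto
  qed
  finally show "emeasure (gaussian_weighted \<nu>) (space (gaussian_weighted \<nu>)) \<noteq> \<infinity>"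
    by simp
qed

text \<open>The distribution of \<open>f\<close> is a Borel measure on the line, and the measures of the half-lines
  \<open>{..<t}\<close> determine it once they are finite.\<close>

lemma nn_integral_cong_sublevel:
  fixes f :: "'a \<Rightarrow> real" and g :: "real \<Rightarrow> ennreal"
  assumes sets_eq: "sets M = sets N"
    and f [measurable]: "f \<in> borel_measurable M" and g [measurable]: "g \<in> borel_measurable borel"
    and eq: "\<And>t. emeasure M {x \<in> space M. f x < t} = emeasure N {x \<in> space N. f x < t}"
    and fin: "\<And>t. emeasure M {x \<in> space M. f x < t} \<noteq> \<infinity>"
  shows "(\<integral>\<^sup>+x. g (f x) \<partial>M) = (\<integral>\<^sup>+x. g (f x) \<partial>N)"
proof -
  have f' [measurable]: "f \<in> borel_measurable N"
    using f measurable_cong_sets[OF sets_eq refl] by blast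
  have dM: "emeasure (distr M borel f) {..<t} = emeasure M {x \<in> space M. f x < t}" for t
    by (subst emeasure_distr) (auto intro!: arg_cong[where f="emeasure M"])
  have dN: "emeasure (distr N borel f) {..<t} = emeasure N {x \<in> space N. f x < t}" for t
    by (subst emeasure_distr) (auto intro!: arg_cong[where f="emeasure N"])
  have "distr M borel f = distr N borel f"
  proof (rule measure_eqI_generator_eq[where \<Omega> = UNIV and E = "range lessThan"
        and A = "\<lambda>i. {..<real i}"])
    show "Int_stable (range (lessThan :: real \<Rightarrow> _))"
    proof (unfold Int_stable_def, safe)
      fix a b :: real
      have "{..<a} \<inter> {..<b} = {..<min a b}"
        by auto
      then show "{..<a} \<inter> {..<b} \<in> range lessThan"
        by blast
    qed
    show "(\<Union>i. {..<real i}) = UNIV"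
      using reals_Archimedean2 by auto
    show "sets (distr M borel f) = sigma_sets UNIV (range lessThan)"
      "sets (distr N borel f) = sigma_sets UNIV (range lessThan)"
      by (simp_all add: borel_Iio)
    show "emeasure (distr M borel f) {..<real i} \<noteq> \<infinity>" for i
      by (simp only: dM fin not_False_eq_True)
  qed (auto simp: dM dN eq)
  then have "(\<integral>\<^sup>+y. g y \<partial>distr M borel f) = (\<integral>\<^sup>+y. g y \<partial>distr N borel f)"
    by simp
  then show ?thesis
    by (simp add: nn_integral_distr)
qed

text \<open>The weight supplies the term \<open>(norm x)\<^sup>2\<close> that turns the semidefinite form \<open>sum_squares vs\<close> into
  a definite one, whose sublevel sets are ellipsoids. This is the only place where the hypothesis on
  ellipsoids enters.\<close>

lemma gaussian_moments_eq:
  fixes \<nu>\<^sub>1 \<nu>\<^sub>2 :: "(real ^ 'n::finite) measure"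
  assumes growth: "\<nu>\<^sub>1 \<in> growth_measures" "\<nu>\<^sub>2 \<in> growth_measures"
    and eq: "\<And>E. centered_ellipsoid E \<Longrightarrow> emeasure \<nu>\<^sub>1 E = emeasure \<nu>\<^sub>2 E"
  shows "(\<integral>x. exp (- sum_squares vs x) \<partial>gaussian_weighted \<nu>\<^sub>1)
    = (\<integral>x. exp (- sum_squares vs x) \<partial>gaussian_weighted \<nu>\<^sub>2)"
proof -
  let ?q = "\<lambda>x. (norm x)\<^sup>2 + sum_squares vs x"
  have sets_nu [simp, measurable_cong]: "sets \<nu>\<^sub>1 = sets borel" "sets \<nu>\<^sub>2 = sets borel"
    using growth by (simp_all add: growth_measures_def)
  have sp [simp]: "space \<nu>\<^sub>1 = UNIV" "space \<nu>\<^sub>2 = UNIV"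
    using sets_eq_imp_space_eq[OF sets_nu(1)] sets_eq_imp_space_eq[OF sets_nu(2)] by simp_all
  have "(\<integral>\<^sup>+x. ennreal (exp (- ?q x)) \<partial>\<nu>\<^sub>1) = (\<integral>\<^sup>+x. ennreal (exp (- ?q x)) \<partial>\<nu>\<^sub>2)"
  proof (rule nn_integral_cong_sublevel[where g = "\<lambda>t. ennreal (exp (- t))"])
    fix t
    show "emeasure \<nu>\<^sub>1 {x \<in> space \<nu>\<^sub>1. ?q x < t} = emeasure \<nu>\<^sub>2 {x \<in> space \<nu>\<^sub>2. ?q x < t}"
    proof (cases "t > 0")
      case True
      then show ?thesis
        using eq[OF centered_ellipsoid_sublevel] by simp
    next
      case False
      then have "{x. ?q x < t} = {}"
        by (auto simp: not_less intro: order_trans[OF _ add_nonneg_nonneg])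
      then show ?thesis
        by simp
    qed
    have "{x. ?q x < t} \<subseteq> ball 0 (sqrt t)"
    proof
      fix x assume "x \<in> {x. ?q x < t}"
      then have "(norm x)\<^sup>2 < t"
        using sum_squares_nonneg[of vs x] unfolding mem_Collect_eq by linarith
      then show "x \<in> ball 0 (sqrt t)"
        by (simp add: real_less_rsqrt)
    qed
    then have "emeasure \<nu>\<^sub>1 {x. ?q x < t} \<le> emeasure \<nu>\<^sub>1 (ball 0 (sqrt t))"
      by (intro emeasure_mono) auto
    also have "\<dots> < \<infinity>"
      using growth by (rule_tac growth_measure_ball_finite)
    finally show "emeasure \<nu>\<^sub>1 {x \<in> space \<nu>\<^sub>1. ?q x < t} \<noteq> \<infinity>"
      by simp
  qed simp_all
  then have "(\<integral>x. exp (- ?q x) \<partial>\<nu>\<^sub>1) = (\<integral>x. exp (- ?q x) \<partial>\<nu>\<^sub>2)"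
    by (subst (1 2) integral_eq_nn_integral) auto
  moreover have "(\<integral>x. exp (- sum_squares vs x) \<partial>gaussian_weighted \<nu>) = (\<integral>x. exp (- ?q x) \<partial>\<nu>)"
    if [measurable_cong, simp]: "sets \<nu> = sets borel" for \<nu> :: "(real ^ 'n) measure"
    unfolding gaussian_weighted_def by (subst integral_density) (simp_all add: exp_add[symmetric])
  ultimately show ?thesis
    by simp
qed

section \<open>Finite measures on a compact set are determined by their moments\<close>

lemma integral_continuous_cong_moments:
  fixes M N :: "'a::euclidean_space measure" and f :: "'a \<Rightarrow> real"
  assumes fin: "finite_measure M" "finite_measure N"
    and sets_MN [simp, measurable_cong]: "sets M = sets borel" "sets N = sets borel"
    and K: "compact K" "AE x in M. x \<in> K" "AE x in N. x \<in> K"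
    and moments: "\<And>p. real_polynomial_function p \<Longrightarrow> (\<integral>x. p x \<partial>M) = (\<integral>x. p x \<partial>N)"
    and f: "continuous_on UNIV f"
  shows "(\<integral>x. f x \<partial>M) = (\<integral>x. f x \<partial>N)"
proof -
  have cont_int: "integrable L h"
    if "finite_measure L" "sets L = sets borel" "AE x in L. x \<in> K" "continuous_on UNIV h"
    for L and h :: "'a \<Rightarrow> real"
  proof -
    interpret finite_measure L by fact
    have "compact (h ` K)"
      using that K(1) by (intro compact_continuous_image) (auto intro: continuous_on_subset)
    then obtain B where "\<And>x. x \<in> K \<Longrightarrow> norm (h x) \<le> B"
      using compact_imp_bounded bounded_iff by (metis imageI)
    then show ?thesis
      using that
      by (intro integrable_const_bound[of _ B])
        (auto intro: borel_measurable_continuous_onI simp: measurable_cong_sets[OF that(2) refl])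
  qed
  have approx: "\<bar>(\<integral>x. f x \<partial>L) - (\<integral>x. p x \<partial>L)\<bar> \<le> e * measure L (space L)"
    if L: "finite_measure L" "sets L = sets borel" "AE x in L. x \<in> K"
      and p: "real_polynomial_function p" "\<And>x. x \<in> K \<Longrightarrow> \<bar>f x - p x\<bar> < e" for L p e
  proof -
    interpret finite_measure L by fact
    have cp: "continuous_on UNIV p"
      using p(1) by (simp add: continuous_on_polymonial_function real_polynomial_function_eq)
    have int: "integrable L f" "integrable L p"
      using L f cp by (auto intro: cont_int)
    have "\<bar>(\<integral>x. f x \<partial>L) - (\<integral>x. p x \<partial>L)\<bar> = \<bar>\<integral>x. f x - p x \<partial>L\<bar>"
      using int by simp
    also have "\<dots> \<le> (\<integral>x. \<bar>f x - p x\<bar> \<partial>L)"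
      by (rule integral_abs_bound)
    also have "\<dots> \<le> (\<integral>x. e \<partial>L)"
      using L(3) int p(2) by (intro integral_mono_AE) (auto intro: less_imp_le)
    finally show ?thesis
      by (simp add: mult.commute)
  qed
  let ?m = "measure M (space M) + measure N (space N)"
  have "\<bar>(\<integral>x. f x \<partial>M) - (\<integral>x. f x \<partial>N)\<bar> \<le> 0"
  proof (rule field_le_epsilon)
    fix e :: real assume e: "e > 0"
    define d where "d = e / (?m + 1)"
    have m: "?m \<ge> 0"
      by simp
    have d: "d > 0"
      unfolding d_def by (rule divide_pos_pos[OF e add_nonneg_pos[OF m zero_less_one]])
    obtain p where p: "real_polynomial_function p" "\<And>x. x \<in> K \<Longrightarrow> \<bar>f x - p x\<bar> < d"
      using Stone_Weierstrass_real_polynomial_function[OF K(1) continuous_on_subset[OF f] d] by auto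
    have "\<bar>(\<integral>x. f x \<partial>M) - (\<integral>x. f x \<partial>N)\<bar> \<le> d * ?m"
      using approx[OF fin(1) sets_MN(1) K(2) p] approx[OF fin(2) sets_MN(2) K(3) p] moments[OF p(1)]
      by (simp add: distrib_left)
    also have "\<dots> \<le> d * (?m + 1)"
      using d by (intro mult_left_mono) auto
    also have "\<dots> = e"
      unfolding d_def using add_nonneg_pos[OF m zero_less_one] by simp
    finally show "\<bar>(\<integral>x. f x \<partial>M) - (\<integral>x. f x \<partial>N)\<bar> \<le> 0 + e"
      by simp
  qed
  then show ?thesis
    by simp
qed

text \<open>Polynomials are uniformly dense on \<open>K\<close>, so all continuous functions have equal integrals, and the
  indicator of a closed set is a decreasing limit of continuous functions.\<close>

lemma finite_measure_eqI_moments: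
  fixes M N :: "'a::euclidean_space measure"
  assumes fin: "finite_measure M" "finite_measure N"
    and sets_MN [simp, measurable_cong]: "sets M = sets borel" "sets N = sets borel"
    and K: "compact K" "AE x in M. x \<in> K" "AE x in N. x \<in> K"
    and moments: "\<And>p. real_polynomial_function p \<Longrightarrow> (\<integral>x. p x \<partial>M) = (\<integral>x. p x \<partial>N)"
  shows "M = N"
proof -
  have sp [simp]: "space M = UNIV" "space N = UNIV"
    using sets_eq_imp_space_eq[OF sets_MN(1)] sets_eq_imp_space_eq[OF sets_MN(2)] by simp_all
  have measure_closed: "measure M C = measure N C" if C: "closed C" "C \<noteq> {}" for C
  proof -
    \<comment> \<open>The value is \<open>1\<close> on \<open>C\<close> and \<open>0\<close> at distance at least \<open>1 / k\<close> from \<open>C\<close>. Nonemptiness of \<open>C\<close>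
      matters because \<open>infdist x {} = 0\<close>.\<close>
    define f where "f k x = max 0 (1 - real k * infdist x C)" for k and x :: 'a
    have f_cont: "continuous_on UNIV (f k)" for k
      unfolding f_def by (intro continuous_intros)
    have f_lim: "(\<lambda>k. f k x) \<longlonglongrightarrow> indicator C x" for x
    proof (cases "x \<in> C")
      case True
      then show ?thesis
        by (simp add: f_def)
    next
      case False
      then have pos: "infdist x C > 0"
        using C by (metis in_closed_iff_infdist_zero infdist_nonneg less_eq_real_def)
      then obtain n where n: "1 < real n * infdist x C"
        using reals_Archimedean3 by blast
      have "f k x = 0" if "k \<ge> n" for k
      proof -
        have "real n * infdist x C \<le> real k * infdist x C"
          using that pos by simp
        then show ?thesis
          using n by (simp add: f_def)
      qed
      then have "eventually (\<lambda>k. f k x = 0) sequentially"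
        by (auto simp: eventually_sequentially)
      then show ?thesis
        using False by (simp add: tendsto_eventually)
    qed
    have lim: "(\<lambda>k. \<integral>x. f k x \<partial>L) \<longlonglongrightarrow> measure L C"
      if L: "finite_measure L" "sets L = sets borel" for L
    proof -
      interpret finite_measure L by fact
      note [measurable_cong] = L(2)
      have [measurable]: "C \<in> sets borel" "\<And>k. f k \<in> borel_measurable borel"
        using C f_cont by (auto intro: borel_measurable_continuous_onI)
      have "(\<lambda>k. \<integral>x. f k x \<partial>L) \<longlonglongrightarrow> (\<integral>x. indicator C x \<partial>L)"
      proof (rule integral_dominated_convergence[where w = "\<lambda>_. 1"])
        show "AE x in L. norm (f k x) \<le> 1" for k
          by (intro AE_I2) (simp add: f_def infdist_nonneg)
      qed (use f_lim in auto)
      then show ?thesis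
        using sets_eq_imp_space_eq[OF L(2)] by simp
    qed
    have "(\<integral>x. f k x \<partial>M) = (\<integral>x. f k x \<partial>N)" for k
      using integral_continuous_cong_moments[OF fin sets_MN K moments f_cont] by simp
    then show ?thesis
      using LIMSEQ_unique lim[OF fin(1) sets_MN(1)] lim[OF fin(2) sets_MN(2)] by simp
  qed
  interpret M: finite_measure M by fact
  interpret N: finite_measure N by fact
  show ?thesis
  proof (rule measure_eqI_generator_eq[where \<Omega> = UNIV and E = "Collect closed" and A = "\<lambda>_. UNIV"])
    show "emeasure M C = emeasure N C" if "C \<in> Collect closed" for C
      using that measure_closed[of C]
      by (cases "C = {}") (simp_all add: M.emeasure_eq_measure N.emeasure_eq_measure)
    show "sets M = sigma_sets UNIV (Collect closed)" "sets N = sigma_sets UNIV (Collect closed)"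
      by (simp_all add: borel_eq_closed)
  qed (auto simp: Int_stable_def)
qed

section \<open>An embedding of the space modulo sign into a cube\<close>

text \<open>The linear span of the functions \<open>exp (- sum_squares vs x)\<close>. Since sums of squares add under
  concatenation of the lists, it is an algebra, and so an integral known on its generators is known on
  all polynomial expressions in them.\<close>

inductive gaussian_span :: "('a::real_inner \<Rightarrow> real) \<Rightarrow> bool" where
  gauss: "gaussian_span (\<lambda>x. c * exp (- sum_squares vs x))"
| add: "gaussian_span f \<Longrightarrow> gaussian_span g \<Longrightarrow> gaussian_span (\<lambda>x. f x + g x)"

lemma gaussian_span_const: "gaussian_span (\<lambda>x. c)"
  using gauss[of c "[]"] by simp

lemma gaussian_span_sum:
  "(\<And>i. i \<in> I \<Longrightarrow> gaussian_span (f i)) \<Longrightarrow> gaussian_span (\<lambda>x. \<Sum>i\<in>I. f i x)"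
proof (induction I rule: infinite_finite_induct)
  case (insert i I)
  then have "gaussian_span (\<lambda>x. f i x + (\<Sum>i\<in>I. f i x))"
    by (intro add) auto
  with insert.hyps show ?case by simp
qed (simp_all add: gaussian_span_const)

lemma gaussian_span_mult:
  assumes "gaussian_span f" "gaussian_span g"
  shows "gaussian_span (\<lambda>x. f x * g x)"
  using assms
proof (induction rule: gaussian_span.induct)
  case (gauss c vs)
  from gauss show ?case
  proof (induction rule: gaussian_span.induct)
    case (gauss d ws)
    show ?case
      using gaussian_span.gauss[of "c * d" "vs @ ws"]
      by (simp add: exp_add[symmetric] exp_diff exp_minus field_simps)
  next
    case (add f g)
    then show ?case
      using gaussian_span.add[OF add.IH] by (simp add: algebra_simps)
  qed
next
  case (add f1 f2)
  then show ?case
    using gaussian_span.add[OF add.IH] by (simp add: algebra_simps)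
qed

lemma gaussian_span_integrable:
  fixes M :: "'a::euclidean_space measure"
  assumes "gaussian_span f" "finite_measure M" "sets M = sets borel"
  shows "integrable M f"
  using assms(1)
proof induction
  case (gauss c vs)
  interpret finite_measure M by fact
  note [measurable_cong] = assms(3)
  show ?case
    by (rule integrable_const_bound[of _ "\<bar>c\<bar>"]) (auto simp: abs_mult mult_left_le)
qed auto

lemma gaussian_span_integral_eq:
  fixes M N :: "'a::euclidean_space measure"
  assumes fin: "finite_measure M" "finite_measure N"
    and sets_MN: "sets M = sets borel" "sets N = sets borel"
    and eq: "\<And>vs. (\<integral>x. exp (- sum_squares vs x) \<partial>M) = (\<integral>x. exp (- sum_squares vs x) \<partial>N)"
    and f: "gaussian_span f"
  shows "(\<integral>x. f x \<partial>M) = (\<integral>x. f x \<partial>N)"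
  using f
proof induction
  case (add f g)
  then show ?case
    using gaussian_span_integrable[of _ M] gaussian_span_integrable[of _ N] fin sets_MN by simp
qed (simp add: eq)

text \<open>Each coordinate is a function of \<open>x x\<^sup>T\<close>, hence even, and together the coordinates determine
  \<open>x x\<^sup>T\<close> by polarization. The exponential keeps the values in a compact set and makes the coordinates
  elements of \<open>gaussian_span\<close>.\<close>

definition sign_embedding :: "real ^ 'n::finite \<Rightarrow> real ^ 'n ^ 'n" where
  "sign_embedding x = (\<chi> i j. exp (- (x $ i + x $ j)\<^sup>2))"

lemma continuous_sign_embedding: "continuous_on A sign_embedding"
  unfolding sign_embedding_def by (intro continuous_intros)

lemma sign_embedding_in_cbox: "sign_embedding x \<in> cbox 0 (\<chi> i j. 1)"
  by (auto simp: sign_embedding_def mem_box Basis_vec_def inner_axis)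

text \<open>The matrix \<open>x x\<^sup>T\<close> is recovered from the squares \<open>(x\<^sub>i + x\<^sub>j)\<^sup>2\<close>. The row of a nonzero entry
  \<open>x\<^sub>k\<close> then fixes \<open>x\<close> up to the sign of \<open>x\<^sub>k\<close>.\<close>

lemma sign_embedding_eq_iff: "sign_embedding x = sign_embedding y \<longleftrightarrow> x = y \<or> x = - y"
proof
  assume "sign_embedding x = sign_embedding y"
  then have sq: "(x $ i + x $ j)\<^sup>2 = (y $ i + y $ j)\<^sup>2" for i j
    by (simp add: sign_embedding_def vec_eq_iff)
  have diag: "(x $ i)\<^sup>2 = (y $ i)\<^sup>2" for i
    using sq[of i i] by (simp add: power_mult_distrib flip: mult_2)
  have prod: "x $ i * x $ j = y $ i * y $ j" for i j
    using sq[of i j] diag[of i] diag[of j] by (simp add: power2_sum)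
  show "x = y \<or> x = - y"
  proof (cases "x = 0")
    case True
    have "y $ i = 0" for i
      using diag[of i] True by simp
    then have "y = 0"
      by (simp add: vec_eq_iff)
    then show ?thesis
      using True by simp
  next
    case False
    then obtain k where k: "x $ k \<noteq> 0"
      by (auto simp: vec_eq_iff)
    from diag[of k] consider "y $ k = x $ k" | "y $ k = - x $ k"
      by (auto simp: power2_eq_iff)
    then show ?thesis
    proof cases
      case 1
      have "x $ j = y $ j" for j
      proof -
        have "x $ k * x $ j = x $ k * y $ j"
          using prod[of k j] 1 by simp
        then show ?thesis
          using k mult_left_cancel by blast
      qed
      then have "x = y"
        by (simp add: vec_eq_iff)
      then show ?thesis ..
    next
      case 2
      have "x $ j = - y $ j" for j
      proof -
        have "x $ k * x $ j = x $ k * (- y $ j)"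
          using prod[of k j] 2 by simp
        then show ?thesis
          using k mult_left_cancel by blast
      qed
      then have "x = - y"
        by (simp add: vec_eq_iff)
      then show ?thesis ..
    qed
  qed
next
  have "sign_embedding (- y) = sign_embedding y"
  proof -
    have "(- a + - b)\<^sup>2 = (a + b)\<^sup>2" for a b :: real
      by (metis minus_add_distrib power2_minus)
    then show ?thesis
      unfolding sign_embedding_def uminus_vec_def by simp
  qed
  moreover assume "x = y \<or> x = - y"
  ultimately show "sign_embedding x = sign_embedding y"
    by metis
qed

lemma gaussian_span_polynomial_sign_embedding:
  assumes "real_polynomial_function (p :: real ^ 'n::finite ^ 'n \<Rightarrow> real)"
  shows "gaussian_span (\<lambda>x. p (sign_embedding x))"
  using assms
proof induction
  case (linear f)
  interpret bounded_linear f by fact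
  have "f (sign_embedding x) = (\<Sum>b\<in>Basis. (sign_embedding x \<bullet> b) * f b)" for x
  proof -
    have "f (sign_embedding x) = f (\<Sum>b\<in>Basis. (sign_embedding x \<bullet> b) *\<^sub>R b)"
      by (simp add: euclidean_representation)
    then show ?thesis
      by (simp add: sum scale)
  qed
  moreover have "gaussian_span (\<lambda>x. (sign_embedding x \<bullet> b) * f b)" if "b \<in> Basis" for b
  proof -
    obtain i j where b: "b = axis i (axis j 1)"
      using \<open>b \<in> Basis\<close> by (auto simp: Basis_vec_def)
    show ?thesis
      using gaussian_span.gauss[of "f b" "[axis i 1 + axis j 1 :: real ^ 'n]"]
      by (simp add: b inner_axis sign_embedding_def inner_add_left inner_axis' inner_real_def mult.commute)
  qed
  ultimately show ?case
    using gaussian_span_sum[of Basis "\<lambda>b x. (sign_embedding x \<bullet> b) * f b"] by simp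
next
  case (const c)
  show ?case by (rule gaussian_span_const)
next
  case (add p q)
  then show ?case by (intro gaussian_span.add) auto
next
  case (mult p q)
  then show ?case by (intro gaussian_span_mult) auto
qed

section \<open>Even measures\<close>

lemma sets_borel_eq_compact:
  "sets (borel :: 'a::euclidean_space measure) = sigma_sets UNIV (Collect compact)"
proof -
  have "sigma_sets UNIV (Collect closed) = sigma_sets UNIV (Collect compact :: 'a set set)"
  proof (rule sigma_sets_eqI)
    fix C :: "'a set" assume "C \<in> Collect closed"
    then have compact: "\<And>n. C \<inter> cball 0 (real n) \<in> sigma_sets UNIV (Collect compact)"
      by (intro sigma_sets.Basic) (auto intro: closed_Int_compact)
    have "C = (\<Union>n. C \<inter> cball 0 (real n))"
      using real_arch_simple by auto
    also have "\<dots> \<in> sigma_sets UNIV (Collect compact)"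
      by (rule sigma_sets.Union) (rule compact)
    finally show "C \<in> sigma_sets UNIV (Collect compact)" .
  qed (auto intro: compact_imp_closed)
  then show ?thesis
    by (simp add: borel_eq_closed)
qed

text \<open>For an even measure, \<open>K\<close> and \<open>- K\<close> have the same measure, so twice the measure of \<open>K\<close> is the
  sum of the measures of \<open>K \<union> - K\<close> and \<open>K \<inter> - K\<close>, which are both symmetric. Compact sets form
  the generator here because their images under a continuous map are again compact, hence Borel.\<close>

lemma even_finite_measure_eqI:
  fixes M N :: "'a::euclidean_space measure"
  assumes fin: "finite_measure M" "finite_measure N"
    and sets_MN [simp]: "sets M = sets borel" "sets N = sets borel"
    and even: "\<And>K. compact K \<Longrightarrow> emeasure M (uminus ` K) = emeasure M K"
       "\<And>K. compact K \<Longrightarrow> emeasure N (uminus ` K) = emeasure N K"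
    and eq: "\<And>K. compact K \<Longrightarrow> uminus ` K = K \<Longrightarrow> emeasure M K = emeasure N K"
  shows "M = N"
proof -
  interpret M: finite_measure M by fact
  interpret N: finite_measure N by fact
  have eq_compact: "emeasure M K = emeasure N K" if "compact K" for K
  proof -
    let ?K' = "uminus ` K"
    have K': "compact ?K'"
      using that by (simp add: compact_negations)
    have double: "2 * measure L K = measure L (K \<union> ?K') + measure L (K \<inter> ?K')"
      if "finite_measure L" "sets L = sets borel" "emeasure L ?K' = emeasure L K" for L
    proof -
      interpret finite_measure L by fact
      have "emeasure L K + emeasure L ?K' = emeasure L (K \<union> ?K') + emeasure L (K \<inter> ?K')"
        using that \<open>compact K\<close> K' by (intro emeasure_Un_Int) (auto simp: borel_compact)
      then have "measure L K + measure L ?K' = measure L (K \<union> ?K') + measure L (K \<inter> ?K')"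
        by (simp add: emeasure_eq_measure flip: ennreal_plus)
      moreover have "measure L ?K' = measure L K"
        using that by (simp add: measure_def)
      ultimately show ?thesis
        by simp
    qed
    have "uminus ` (K \<union> ?K') = K \<union> ?K'" "uminus ` (K \<inter> ?K') = K \<inter> ?K'"
      by (simp_all add: image_Un image_Int[OF inj_uminus] image_image Un_commute Int_commute)
    then have "measure M (K \<union> ?K') = measure N (K \<union> ?K')" "measure M (K \<inter> ?K') = measure N (K \<inter> ?K')"
      using that K' by (simp_all add: measure_def eq compact_Un compact_Int)
    then have "measure M K = measure N K"
      using double[OF fin(1) sets_MN(1) even(1)[OF that]] double[OF fin(2) sets_MN(2) even(2)[OF that]]
      by simp
    then show ?thesis
      by (simp add: M.emeasure_eq_measure N.emeasure_eq_measure)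
  qed
  show ?thesis
  proof (rule measure_eqI_generator_eq[where \<Omega> = UNIV and E = "Collect compact"
        and A = "\<lambda>n. cball 0 (real n)"])
    show "sets M = sigma_sets UNIV (Collect compact)" "sets N = sigma_sets UNIV (Collect compact)"
      by (simp_all add: sets_borel_eq_compact)
    show "(\<Union>n. cball 0 (real n)) = (UNIV :: 'a set)"
      using real_arch_simple by auto
  qed (auto simp: Int_stable_def eq_compact)
qed

lemma gaussian_weighted_even:
  fixes \<nu> :: "(real ^ 'n::finite) measure"
  assumes "\<nu> \<in> even_growth_measures" and U [measurable]: "U \<in> sets borel"
  shows "emeasure (gaussian_weighted \<nu>) (uminus ` U) = emeasure (gaussian_weighted \<nu>) U"
proof -
  have [simp, measurable_cong]: "sets \<nu> = sets borel"
    using assms by (simp add: even_growth_measures_def growth_measures_def)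
  have neg: "uminus ` A = uminus -` A" for A :: "(real ^ 'n) set"
    by force
  have [measurable]: "uminus -` U \<in> sets borel"
    using measurable_sets[of "uminus :: real^'n \<Rightarrow> _" borel borel U] U by simp
  have sp: "space \<nu> = UNIV"
    using sets_eq_imp_space_eq[of \<nu> borel] by simp
  have distr: "distr \<nu> borel uminus = \<nu>"
  proof (rule measure_eqI)
    fix A assume A: "A \<in> sets (distr \<nu> borel uminus)"
    then have "emeasure (distr \<nu> borel uminus) A = emeasure \<nu> (uminus ` A)"
      by (simp add: emeasure_distr sp neg)
    then show "emeasure (distr \<nu> borel uminus) A = emeasure \<nu> A"
      using assms A by (simp add: even_growth_measures_def)
  qed simp
  have "emeasure (gaussian_weighted \<nu>) U
      = (\<integral>\<^sup>+x. ennreal (exp (- (norm x)\<^sup>2)) * indicator U x \<partial>distr \<nu> borel uminus)"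
    by (simp add: distr gaussian_weighted_def emeasure_density)
  also have "\<dots> = (\<integral>\<^sup>+x. ennreal (exp (- (norm x)\<^sup>2)) * indicator (uminus -` U) x \<partial>\<nu>)"
    by (subst nn_integral_distr) (auto simp: indicator_def intro!: nn_integral_cong)
  also have "\<dots> = emeasure (gaussian_weighted \<nu>) (uminus ` U)"
    by (simp add: neg gaussian_weighted_def emeasure_density)
  finally show ?thesis ..
qed

lemma gaussian_weighted_inject:
  assumes "gaussian_weighted \<nu>\<^sub>1 = gaussian_weighted \<nu>\<^sub>2" "sets \<nu>\<^sub>1 = sets borel" "sets \<nu>\<^sub>2 = sets borel"
  shows "\<nu>\<^sub>1 = \<nu>\<^sub>2"
proof -
  have "density (gaussian_weighted \<nu>) (\<lambda>x. ennreal (exp ((norm x)\<^sup>2))) = \<nu>"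
    if [measurable_cong]: "sets \<nu> = sets borel" for \<nu> :: "'a measure"
    unfolding gaussian_weighted_def
    by (subst density_density_eq)
       (simp_all add: ennreal_mult[symmetric] exp_add[symmetric] density_1)
  then show ?thesis
    using assms by metis
qed

section \<open>Determination by ellipsoids\<close>

theorem theorem0p17:
  fixes \<nu>\<^sub>1 \<nu>\<^sub>2 :: "(real ^ 'n::finite) measure"
  assumes "CARD('n) > 1"
    and "\<nu>\<^sub>1 \<in> even_growth_measures" and "\<nu>\<^sub>2 \<in> even_growth_measures"
    and "\<And>E. centered_ellipsoid E \<Longrightarrow> emeasure \<nu>\<^sub>1 E = emeasure \<nu>\<^sub>2 E"
  shows "\<nu>\<^sub>1 = \<nu>\<^sub>2"
proof -
  let ?M = "gaussian_weighted \<nu>\<^sub>1" and ?N = "gaussian_weighted \<nu>\<^sub>2"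
  let ?\<Phi> = "sign_embedding :: real ^ 'n \<Rightarrow> real ^ 'n ^ 'n"
  have growth: "\<nu>\<^sub>1 \<in> growth_measures" "\<nu>\<^sub>2 \<in> growth_measures"
    using assms(2,3) by (simp_all add: even_growth_measures_def)
  have sets_nu: "sets \<nu>\<^sub>1 = sets borel" "sets \<nu>\<^sub>2 = sets borel"
    using growth by (simp_all add: growth_measures_def)
  have sets_MN [simp, measurable_cong]: "sets ?M = sets borel" "sets ?N = sets borel"
    using sets_nu by simp_all
  have sp [simp]: "space ?M = UNIV" "space ?N = UNIV"
    using sets_eq_imp_space_eq[OF sets_MN(1)] sets_eq_imp_space_eq[OF sets_MN(2)] by simp_all
  have fin: "finite_measure ?M" "finite_measure ?N"
    using growth by (simp_all add: finite_gaussian_weighted)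
  have \<Phi> [measurable]: "?\<Phi> \<in> borel_measurable borel"
    by (intro borel_measurable_continuous_onI continuous_sign_embedding)
  have distr_eq: "distr ?M borel ?\<Phi> = distr ?N borel ?\<Phi>"
  proof (rule finite_measure_eqI_moments[where K = "cbox 0 (\<chi> i j. 1)"])
    show "finite_measure (distr ?M borel ?\<Phi>)" "finite_measure (distr ?N borel ?\<Phi>)"
      using fin by (auto intro!: finite_measure.finite_measure_distr)
    show "AE y in distr ?M borel ?\<Phi>. y \<in> cbox 0 (\<chi> i j. 1)"
      "AE y in distr ?N borel ?\<Phi>. y \<in> cbox 0 (\<chi> i j. 1)"
      by (simp_all add: AE_distr_iff sign_embedding_in_cbox)
    fix p :: "real ^ 'n ^ 'n \<Rightarrow> real" assume p: "real_polynomial_function p"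
    then have [measurable]: "p \<in> borel_measurable borel"
      by (intro borel_measurable_continuous_onI)
        (simp add: continuous_on_polymonial_function real_polynomial_function_eq)
    show "(\<integral>y. p y \<partial>distr ?M borel ?\<Phi>) = (\<integral>y. p y \<partial>distr ?N borel ?\<Phi>)"
      using gaussian_span_integral_eq[OF fin sets_MN gaussian_moments_eq[OF growth assms(4)]
          gaussian_span_polynomial_sign_embedding[OF p]]
      by (simp add: integral_distr)
  qed simp_all
  have "?M = ?N"
  proof (rule even_finite_measure_eqI[OF fin sets_MN])
    fix K :: "(real ^ 'n) set" assume K: "compact K" and sym: "uminus ` K = K"
    have "compact (?\<Phi> ` K)"
      using K by (intro compact_continuous_image continuous_sign_embedding)
    then have [measurable]: "?\<Phi> ` K \<in> sets borel"
      by (rule borel_compact)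
    have "x \<in> K" if "?\<Phi> x \<in> ?\<Phi> ` K" for x
    proof -
      from that obtain y where "y \<in> K" "?\<Phi> x = ?\<Phi> y"
        by blast
      then have "y \<in> K" "x = y \<or> x = - y"
        by (simp_all add: sign_embedding_eq_iff)
      then show ?thesis
        using sym by auto
    qed
    \<comment> \<open>A symmetric set is a union of fibres of the embedding.\<close>
    then have "?\<Phi> -` (?\<Phi> ` K) = K"
      by blast
    then have "emeasure ?M K = emeasure (distr ?M borel ?\<Phi>) (?\<Phi> ` K)"
      "emeasure ?N K = emeasure (distr ?N borel ?\<Phi>) (?\<Phi> ` K)"
      by (simp_all add: emeasure_distr)
    then show "emeasure ?M K = emeasure ?N K"
      by (simp add: distr_eq)
  qed (use assms(2,3) in \<open>simp_all add: gaussian_weighted_even borel_compact\<close>)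
  then show ?thesis
    using sets_nu by (rule gaussian_weighted_inject)
qed

end
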